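(* Let $s,N\ge1$ and let $A:\mathbb N\to\mathbb C^{s\times s}$ be a matrix sequence. If $A(0)$ is nonsingular, then $$\Pi_N\bigl(A^{(-1)}\bigr)=\bigl(\Pi_NA\bigr)^{-1}\quad\text{in }\mathfrak A_{s,N}.$$
   Context: $\mathbb N=\{0,1,2,\ldots\}$. Convolution of sequences $A,B:\mathbb N\to\mathbb C^{s\times s}$ is $(A*B)(k)=\sum_{\ell=0}^kA(\ell)B(k-\ell)$, with identity $e_0$ given by $e_0(0)=I_s$, $e_0(k)=0$ for $k\ge1$. $A^{(-1)}$ denotes the two-sided convolution inverse of $A$, i.e. the sequence with $A*A^{(-1)}=e_0=A^{(-1)}*A$ (it exists when $A(0)$ is nonsingular). $\mathfrak A_{s,N}=\mathbb C^{s\times s}[x]/\langle x^N\rangle$ is the unital associative ring of truncated polynomials with matrix coefficients ($x$ commuting with coefficients), and $\Pi_NA=\sum_{k=0}^{N-1}A(k)x^k$, identified with its class in $\mathfrak A_{s,N}$. *)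

theory Defs
  imports "HOL-Algebra.UnivPoly" "HOL-Algebra.QuotRing" "Jordan_Normal_Form.Matrix"
begin

abbreviation mat_ring :: "nat \<Rightarrow> complex mat ring" where
  "mat_ring s \<equiv> ring_mat TYPE(complex) s ()"

abbreviation mat_seqs :: "nat \<Rightarrow> (nat \<Rightarrow> complex mat) set" where
  "mat_seqs s \<equiv> UNIV \<rightarrow> carrier_mat s s"

definition conv :: "nat \<Rightarrow> (nat \<Rightarrow> complex mat) \<Rightarrow> (nat \<Rightarrow> complex mat) \<Rightarrow> nat \<Rightarrow> complex mat" where
  "conv s A B k = (\<Oplus>\<^bsub>mat_ring s\<^esub> l \<in> {..k}. A l * B (k - l))"

definition conv_id :: "nat \<Rightarrow> nat \<Rightarrow> complex mat" where
  "conv_id s k = (if k = 0 then 1\<^sub>m s else 0\<^sub>m s s)"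

text \<open>Meaningful only if a two-sided inverse exists, e.g. if \<open>A 0\<close> is nonsingular; such an inverse
  is unique, as convolution is associative.\<close>

definition conv_inv :: "nat \<Rightarrow> (nat \<Rightarrow> complex mat) \<Rightarrow> nat \<Rightarrow> complex mat" where
  "conv_inv s A = (THE B. B \<in> mat_seqs s \<and> conv s A B = conv_id s \<and> conv s B A = conv_id s)"

text \<open>Polynomials are taken over the noncommutative matrix ring, so the indeterminate commutes with
  the coefficients, and \<open>Idl\<close> is the two-sided ideal generated by \<open>x ^ N\<close>.\<close>

abbreviation mat_poly_ring :: "nat \<Rightarrow> (complex mat, nat \<Rightarrow> complex mat) up_ring" where
  "mat_poly_ring s \<equiv> UP (mat_ring s)"

definition trunc_ideal :: "nat \<Rightarrow> nat \<Rightarrow> (nat \<Rightarrow> complex mat) set" where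
  "trunc_ideal s N = Idl\<^bsub>mat_poly_ring s\<^esub> {monom (mat_poly_ring s) (1\<^sub>m s) N}"

definition trunc_ring :: "nat \<Rightarrow> nat \<Rightarrow> (nat \<Rightarrow> complex mat) set ring" where
  "trunc_ring s N = mat_poly_ring s Quot trunc_ideal s N"

definition trunc_poly :: "nat \<Rightarrow> nat \<Rightarrow> (nat \<Rightarrow> complex mat) \<Rightarrow> nat \<Rightarrow> complex mat" where
  "trunc_poly s N A = (\<Oplus>\<^bsub>mat_poly_ring s\<^esub> k \<in> {..<N}. monom (mat_poly_ring s) (A k) k)"

definition trunc_class :: "nat \<Rightarrow> nat \<Rightarrow> (nat \<Rightarrow> complex mat) \<Rightarrow> (nat \<Rightarrow> complex mat) set" where
  "trunc_class s N A = trunc_ideal s N +>\<^bsub>mat_poly_ring s\<^esub> trunc_poly s N A"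

end

theory Submission
  imports Defs
begin

text \<open>The low coefficients of a product of polynomials depend only on the low coefficients of the
  factors, so truncation turns convolution into multiplication modulo \<open>x ^ N\<close>. Hence a two-sided
  convolution inverse truncates to a two-sided inverse in the quotient ring. Right inverses are built
  by recursion; since the value at \<open>0\<close> of a right inverse is again a unit, it has a right inverse
  itself, which makes it two-sided.\<close>

text \<open>The argument uses only ring axioms, so convolution and its unit are set up over an
  arbitrary, possibly noncommutative, ring. The matrix versions become instances of these at the
  end.\<close>

definition cauchy_prod :: "('a, 'm) ring_scheme \<Rightarrow> (nat \<Rightarrow> 'a) \<Rightarrow> (nat \<Rightarrow> 'a) \<Rightarrow> nat \<Rightarrow> 'a" where
  "cauchy_prod R A B k = (\<Oplus>\<^bsub>R\<^esub> l \<in> {..k}. A l \<otimes>\<^bsub>R\<^esub> B (k - l))"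

definition unit_seq :: "('a, 'm) ring_scheme \<Rightarrow> nat \<Rightarrow> 'a" where
  "unit_seq R k = (if k = 0 then \<one>\<^bsub>R\<^esub> else \<zero>\<^bsub>R\<^esub>)"

definition truncation :: "('a, 'm) ring_scheme \<Rightarrow> nat \<Rightarrow> (nat \<Rightarrow> 'a) \<Rightarrow> nat \<Rightarrow> 'a" where
  "truncation R N A = (\<Oplus>\<^bsub>UP R\<^esub> k \<in> {..<N}. monom (UP R) (A k) k)"

section \<open>Convolution and right inverses over a ring\<close>

context ring
begin

lemma cauchy_prod_closed:
  assumes "A \<in> UNIV \<rightarrow> carrier R" "B \<in> UNIV \<rightarrow> carrier R"
  shows "cauchy_prod R A B k \<in> carrier R"
  using assms by (auto simp: cauchy_prod_def intro!: finsum_closed)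

lemma cauchy_prod_cong:
  assumes "A \<in> UNIV \<rightarrow> carrier R" "B \<in> UNIV \<rightarrow> carrier R"
    and "\<And>i. i \<le> k \<Longrightarrow> A i = A' i" "\<And>i. i \<le> k \<Longrightarrow> B i = B' i"
  shows "cauchy_prod R A B k = cauchy_prod R A' B' k"
  unfolding cauchy_prod_def
proof (rule finsum_cong')
  show "(\<lambda>l. A' l \<otimes> B' (k - l)) \<in> {..k} \<rightarrow> carrier R"
    using assms by (auto simp: Pi_iff simp flip: assms(3,4))
qed (use assms in auto)

text \<open>Splitting off the summand at index 0 isolates the only occurrence of
  \<open>B (Suc k)\<close>, with coefficient \<open>A 0\<close>. When \<open>A 0\<close> is a unit,
  a prescribed value of the convolution can therefore be solved for
  \<open>B (Suc k)\<close>.\<close>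

lemma cauchy_prod_Suc:
  assumes "A \<in> UNIV \<rightarrow> carrier R" "B \<in> UNIV \<rightarrow> carrier R"
  shows "cauchy_prod R A B (Suc k) = cauchy_prod R (\<lambda>i. A (Suc i)) B k \<oplus> A 0 \<otimes> B (Suc k)"
  unfolding cauchy_prod_def using assms by (subst finsum_Suc2) (auto simp: Pi_iff)

lemma right_inverse_seq_exists:
  assumes A: "A \<in> UNIV \<rightarrow> carrier R" and U: "A 0 \<in> Units R"
  obtains B where "B \<in> UNIV \<rightarrow> carrier R" "cauchy_prod R A B = unit_seq R"
proof -
  \<comment> \<open>The recursion solves the equation at index \<open>k\<close> for
    \<open>B k\<close>. Padding with zero from \<open>k\<close> onwards makes the right-hand side
    depend on earlier values only, as well-founded choice demands; \<open>k - 1\<close> matters only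
    for positive \<open>k\<close>.\<close>
  let ?P = "\<lambda>B k b. b \<in> carrier R \<and>
    b = inv (A 0) \<otimes> (if k = 0 then \<one> else \<ominus> cauchy_prod R (\<lambda>i. A (Suc i))
          (\<lambda>i. if i < k then B i else \<zero>) (k - 1))"
  have "\<exists>B. \<forall>k. ?P B k (B k)"
  proof (rule dependent_wf_choice[OF wf_less])
    fix f g :: "nat \<Rightarrow> 'a" and k b
    assume "\<And>z. (z, k) \<in> {(x, y). x < y} \<Longrightarrow> f z = g z"
    then have "(\<lambda>i. if i < k then f i else \<zero>) = (\<lambda>i. if i < k then g i else \<zero>)"
      by auto
    then show "?P f k b = ?P g k b" by simp
  next
    fix k and f :: "nat \<Rightarrow> 'a"
    assume f: "\<And>y. (y, k) \<in> {(x, y). x < y} \<Longrightarrow> ?P f y (f y)"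
    have "f y \<in> carrier R" if "y < k" for y using f[of y] that by blast
    then have "cauchy_prod R (\<lambda>i. A (Suc i)) (\<lambda>i. if i < k then f i else \<zero>) (k - 1) \<in> carrier R"
      using A by (intro cauchy_prod_closed) (auto simp: Pi_iff)
    then show "\<exists>b. ?P f k b" using U by simp
  qed
  then obtain B where B: "\<And>k. ?P B k (B k)" by blast
  have Bc: "B \<in> UNIV \<rightarrow> carrier R" using B by blast
  have "cauchy_prod R A B k = unit_seq R k" for k
  proof (cases k)
    case 0
    have "B 0 = inv (A 0)" using B[of 0] U by simp
    then show ?thesis using U 0 A by (auto simp: cauchy_prod_def unit_seq_def)
  next
    case (Suc n)
    let ?c = "cauchy_prod R (\<lambda>i. A (Suc i)) B n"
    have c: "?c \<in> carrier R" using A Bc by (intro cauchy_prod_closed) auto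
    \<comment> \<open>At index \<open>n\<close> the convolution reads \<open>B\<close> only up to
      \<open>n\<close>, which is below \<open>k\<close>, so the padding is invisible.\<close>
    have "?c = cauchy_prod R (\<lambda>i. A (Suc i)) (\<lambda>i. if i < k then B i else \<zero>) (k - 1)"
      unfolding Suc diff_Suc_1 using A Bc by (intro cauchy_prod_cong) auto
    then have "B k = inv (A 0) \<otimes> (\<ominus> ?c)" using B[of k] Suc by simp
    then have "A 0 \<otimes> B k = \<ominus> ?c"
      using U c by (simp add: Units_closed m_assoc[symmetric])
    then show ?thesis using Suc c cauchy_prod_Suc[OF A Bc] by (simp add: unit_seq_def r_neg)
  qed
  then show ?thesis using that Bc by blast
qed

end

section \<open>Convolution laws read off from polynomial products\<close>

context UP_ring
begin

lemma truncation_closed: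
  assumes "A \<in> UNIV \<rightarrow> carrier R"
  shows "truncation R N A \<in> carrier P"
proof -
  interpret P: ring P by (rule UP_ring)
  show ?thesis unfolding truncation_def P_def[symmetric] using assms
    by (intro P.finsum_closed) (auto simp: Pi_iff)
qed

lemma coeff_truncation:
  assumes "A \<in> UNIV \<rightarrow> carrier R"
  shows "coeff P (truncation R N A) n = (if n < N then A n else \<zero>)"
proof (induction N)
  interpret P: ring P by (rule UP_ring)
  case 0
  show ?case by (simp add: truncation_def P_def[symmetric])
next
  interpret P: ring P by (rule UP_ring)
  case (Suc N)
  have "truncation R (Suc N) A = monom P (A N) N \<oplus>\<^bsub>P\<^esub> truncation R N A"
    unfolding truncation_def P_def[symmetric] lessThan_Suc
    using assms by (subst P.finsum_insert) (auto simp: Pi_iff)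
  moreover have "A i \<in> carrier R" for i using assms by auto
  ultimately show ?case using Suc truncation_closed[OF assms, of N]
    by (auto simp: less_Suc_eq)
qed

lemma coeff_truncation_mult:
  assumes A: "A \<in> UNIV \<rightarrow> carrier R" and B: "B \<in> UNIV \<rightarrow> carrier R" and "n < N"
  shows "coeff P (truncation R N A \<otimes>\<^bsub>P\<^esub> truncation R N B) n = cauchy_prod R A B n"
proof -
  have "coeff P (truncation R N A \<otimes>\<^bsub>P\<^esub> truncation R N B) n
      = cauchy_prod R (coeff P (truncation R N A)) (coeff P (truncation R N B)) n"
    using truncation_closed A B by (simp add: cauchy_prod_def)
  also have "\<dots> = cauchy_prod R A B n"
    using assms truncation_closed by (intro R.cauchy_prod_cong) (auto simp: coeff_truncation Pi_iff)
  finally show ?thesis .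
qed

text \<open>Associativity is inherited from the polynomial ring. At a fixed index \<open>n\<close>,
  each sequence may be replaced by its truncation to length \<open>Suc n\<close>, since no later
  entries enter either side.\<close>

lemma cauchy_prod_assoc:
  assumes A: "A \<in> UNIV \<rightarrow> carrier R" and B: "B \<in> UNIV \<rightarrow> carrier R" and C: "C \<in> UNIV \<rightarrow> carrier R"
  shows "cauchy_prod R (cauchy_prod R A B) C = cauchy_prod R A (cauchy_prod R B C)"
proof
  fix n
  let ?T = "truncation R (Suc n)"
  have T: "?T A \<in> carrier P" "?T B \<in> carrier P" "?T C \<in> carrier P"
    using assms by (simp_all add: truncation_closed)
  have "cauchy_prod R (cauchy_prod R A B) C n
      = cauchy_prod R (coeff P (?T A \<otimes>\<^bsub>P\<^esub> ?T B)) (coeff P (?T C)) n"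
    using assms by (intro R.cauchy_prod_cong)
      (auto simp: coeff_truncation coeff_truncation_mult R.cauchy_prod_closed simp del: coeff_mult)
  also have "\<dots> = coeff P (?T A \<otimes>\<^bsub>P\<^esub> ?T B \<otimes>\<^bsub>P\<^esub> ?T C) n"
    using coeff_mult[of "?T A \<otimes>\<^bsub>P\<^esub> ?T B" "?T C" n] T
    by (simp add: cauchy_prod_def del: coeff_mult)
  also have "\<dots> = coeff P (?T A \<otimes>\<^bsub>P\<^esub> (?T B \<otimes>\<^bsub>P\<^esub> ?T C)) n"
    using T by (simp add: UP_m_assoc del: coeff_mult)
  also have "\<dots> = cauchy_prod R (coeff P (?T A)) (coeff P (?T B \<otimes>\<^bsub>P\<^esub> ?T C)) n"
    using coeff_mult[of "?T A" "?T B \<otimes>\<^bsub>P\<^esub> ?T C" n] T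
    by (simp add: cauchy_prod_def del: coeff_mult)
  also have "\<dots> = cauchy_prod R A (cauchy_prod R B C) n"
    using assms T by (intro R.cauchy_prod_cong)
      (auto simp: coeff_truncation coeff_truncation_mult simp del: coeff_mult)
  finally show "cauchy_prod R (cauchy_prod R A B) C n = cauchy_prod R A (cauchy_prod R B C) n" .
qed

lemma cauchy_prod_unit_seq:
  assumes A: "A \<in> UNIV \<rightarrow> carrier R"
  shows "cauchy_prod R (unit_seq R) A = A" "cauchy_prod R A (unit_seq R) = A"
proof -
  have e: "unit_seq R \<in> UNIV \<rightarrow> carrier R" by (simp add: unit_seq_def)
  have "cauchy_prod R (unit_seq R) A n = A n" "cauchy_prod R A (unit_seq R) n = A n" for n
  proof -
    let ?T = "truncation R (Suc n)"
    \<comment> \<open>The length \<open>Suc n\<close> is positive, so the constant term survives the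
      truncation.\<close>
    have T1: "?T (unit_seq R) = \<one>\<^bsub>P\<^esub>"
      by (rule up_eqI) (simp_all add: e coeff_truncation truncation_closed, simp add: unit_seq_def)
    show "cauchy_prod R (unit_seq R) A n = A n" "cauchy_prod R A (unit_seq R) n = A n"
      using coeff_truncation_mult[OF e A, of n "Suc n"] coeff_truncation_mult[OF A e, of n "Suc n"]
      by (simp_all add: T1 truncation_closed[OF A] coeff_truncation[OF A] del: coeff_mult)
  qed
  then show "cauchy_prod R (unit_seq R) A = A" "cauchy_prod R A (unit_seq R) = A" by auto
qed

lemma inverse_seq_unique:
  assumes A: "A \<in> UNIV \<rightarrow> carrier R" and B: "B \<in> UNIV \<rightarrow> carrier R" and C: "C \<in> UNIV \<rightarrow> carrier R"
    and "cauchy_prod R B A = unit_seq R" "cauchy_prod R A C = unit_seq R"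
  shows "B = C"
  using cauchy_prod_assoc[OF B A C] cauchy_prod_unit_seq(1)[OF C] cauchy_prod_unit_seq(2)[OF B] assms(4,5)
  by simp

lemma inverse_seq_exists:
  assumes A: "A \<in> UNIV \<rightarrow> carrier R" and U: "A 0 \<in> Units R"
  obtains B where "B \<in> UNIV \<rightarrow> carrier R"
    "cauchy_prod R A B = unit_seq R" "cauchy_prod R B A = unit_seq R"
proof -
  obtain B where B: "B \<in> UNIV \<rightarrow> carrier R" "cauchy_prod R A B = unit_seq R"
    using R.right_inverse_seq_exists[OF A U] .
  have c: "A 0 \<in> carrier R" "B 0 \<in> carrier R" using A B by (auto simp: Pi_iff)
  have "A 0 \<otimes> B 0 = \<one>"
    using fun_cong[OF B(2), of 0] c by (simp add: cauchy_prod_def unit_seq_def)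
  \<comment> \<open>In a noncommutative ring a left inverse alone does not make \<open>B 0\<close> a
    unit; here \<open>A 0\<close> is already one, so its right inverse \<open>B 0\<close> coincides
    with \<open>inv (A 0)\<close>.\<close>
  then have "B 0 = inv (A 0)"
    using R.inv_unique[OF R.Units_l_inv[OF U], of "B 0"] c U by simp
  then have "B 0 \<in> Units R" using U by simp
  then obtain C where C: "C \<in> UNIV \<rightarrow> carrier R" "cauchy_prod R B C = unit_seq R"
    using R.right_inverse_seq_exists[OF B(1)] by blast
  \<comment> \<open>\<open>A\<close> is a left inverse and \<open>C\<close> a right inverse of
    \<open>B\<close>, so they agree, and the equation for \<open>C\<close> becomes the missing one
    for \<open>A\<close>.\<close>
  have "A = C" using inverse_seq_unique[OF B(1) A C(1)] B C by blast
  then show ?thesis using that B C by blast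
qed

section \<open>Cosets modulo a power of the indeterminate\<close>

lemma monom_one_mult_shift:
  assumes p: "p \<in> carrier P" and low: "\<And>n. n < N \<Longrightarrow> coeff P p n = \<zero>"
  obtains q where "q \<in> carrier P" "p = monom P \<one> N \<otimes>\<^bsub>P\<^esub> q"
proof
  \<comment> \<open>Division by the monomial of degree \<open>N\<close> shifts the coefficients down
    by \<open>N\<close>.\<close>
  let ?q = "\<lambda>i. coeff P p (i + N)"
  have coeff_eq: "coeff P r = r" if "r \<in> up R" for r
    using that by (simp add: P_def UP_def)
  have up: "p \<in> up R" using p by (simp add: P_def UP_def)
  then obtain b where "bound \<zero> b p" using R.bound_upD by blast
  then have "bound \<zero> b ?q" using coeff_eq[OF up] by (auto simp: bound_def)
  then have q: "?q \<in> up R" using p by (intro mem_upI) auto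
  show qP: "?q \<in> carrier P" using q by (simp add: P_def UP_def)
  show "p = monom P \<one> N \<otimes>\<^bsub>P\<^esub> ?q"
  proof (rule up_eqI)
    fix n
    have "coeff P (monom P \<one> N \<otimes>\<^bsub>P\<^esub> ?q) n
        = (\<Oplus>i \<in> {..n}. if N = i then coeff P p (n - i + N) else \<zero>)"
      using p qP by (simp, intro R.finsum_cong') (auto simp: coeff_eq[OF q])
    also have "\<dots> = coeff P p n"
    \<comment> \<open>If \<open>N\<close> is at most \<open>n\<close>, the summand at
      \<open>i = N\<close> survives and \<open>n - N + N\<close> is \<open>n\<close>. Otherwise
      \<open>N\<close> lies outside the range, the sum is zero, and so is the low coefficient of
      \<open>p\<close>.\<close>
    proof (cases "N \<le> n")
      case True
      then show ?thesis using R.finsum_singleton[of N "{..n}" "\<lambda>i. coeff P p (n - i + N)"] p by simp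
    next
      case False
      then have "(\<Oplus>i \<in> {..n}. if N = i then coeff P p (n - i + N) else \<zero>) = (\<Oplus>i \<in> {..n}. \<zero>)"
        by (intro R.finsum_cong') auto
      then show ?thesis using low[of n] False by simp
    qed
    finally show "coeff P p n = coeff P (monom P \<one> N \<otimes>\<^bsub>P\<^esub> ?q) n" by simp
  qed (use p qP in simp_all)
qed

text \<open>The difference has no coefficients below \<open>N\<close>, so it is a multiple of the
  generator and lies in the ideal.\<close>

lemma rcos_eq_if_low_coeffs_eq:
  assumes p: "p \<in> carrier P" and q: "q \<in> carrier P"
    and eq: "\<And>n. n < N \<Longrightarrow> coeff P p n = coeff P q n"
  shows "Idl\<^bsub>P\<^esub> {monom P \<one> N} +>\<^bsub>P\<^esub> p = Idl\<^bsub>P\<^esub> {monom P \<one> N} +>\<^bsub>P\<^esub> q"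
proof -
  interpret P: ring P by (rule UP_ring)
  interpret I: ideal "Idl\<^bsub>P\<^esub> {monom P \<one> N}" P by (rule P.genideal_ideal) simp
  have "p \<ominus>\<^bsub>P\<^esub> q \<in> carrier P" using p q by simp
  moreover have "coeff P (p \<ominus>\<^bsub>P\<^esub> q) n = \<zero>" if "n < N" for n
    using p q eq[OF that] by (simp add: a_minus_def R.r_neg)
  ultimately obtain r where "r \<in> carrier P" "p \<ominus>\<^bsub>P\<^esub> q = monom P \<one> N \<otimes>\<^bsub>P\<^esub> r"
    using monom_one_mult_shift by blast
  then have "p \<ominus>\<^bsub>P\<^esub> q \<in> Idl\<^bsub>P\<^esub> {monom P \<one> N}"
    using P.genideal_self'[of "monom P \<one> N"] by (simp add: I.I_r_closed)
  then show ?thesis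
    using P.quotient_eq_iff_same_a_r_cos[OF I.is_ideal p q] by simp
qed

text \<open>The product of the truncations agrees with the polynomial one below \<open>N\<close>,
  and the coset map is a ring homomorphism. Being one-sided, the statement serves twice, with the
  factors swapped.\<close>

lemma truncation_rcos_mult:
  fixes N :: nat
  defines "I \<equiv> Idl\<^bsub>P\<^esub> {monom P \<one> N}"
  assumes A: "A \<in> UNIV \<rightarrow> carrier R" and B: "B \<in> UNIV \<rightarrow> carrier R"
    and AB: "cauchy_prod R A B = unit_seq R"
  shows "(I +>\<^bsub>P\<^esub> truncation R N A) \<otimes>\<^bsub>P Quot I\<^esub> (I +>\<^bsub>P\<^esub> truncation R N B) = \<one>\<^bsub>P Quot I\<^esub>"
proof -
  interpret P: ring P by (rule UP_ring)
  interpret I: ideal I P unfolding I_def by (rule P.genideal_ideal) simp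
  interpret h: ring_hom_ring P "P Quot I" "(+>\<^bsub>P\<^esub>) I" by (rule I.rcos_ring_hom_ring)
  have c: "truncation R N A \<in> carrier P" "truncation R N B \<in> carrier P"
    using A B by (simp_all add: truncation_closed)
  have "I +>\<^bsub>P\<^esub> (truncation R N A \<otimes>\<^bsub>P\<^esub> truncation R N B) = I +>\<^bsub>P\<^esub> \<one>\<^bsub>P\<^esub>"
    unfolding I_def using c A B
    by (intro rcos_eq_if_low_coeffs_eq)
      (simp_all add: coeff_truncation_mult AB unit_seq_def del: coeff_mult)
  then show ?thesis using c by (metis h.hom_mult h.hom_one)
qed

end

section \<open>The matrix ring and the theorem\<close>

lemma Units_mat_ring:
  assumes "M \<in> carrier_mat s s" "invertible_mat M"
  shows "M \<in> Units (mat_ring s)"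
proof -
  obtain B where B: "inverts_mat M B" "inverts_mat B M"
    using assms(2) by (auto simp: invertible_mat_def)
  then have "M * B = 1\<^sub>m s" "B * M = 1\<^sub>m (dim_row B)" using assms(1) by (auto simp: inverts_mat_def)
  \<comment> \<open>\<open>invertible_mat\<close> does not fix the shape of \<open>B\<close>.
    Comparing column counts in the two products yields both of its dimensions.\<close>
  then have "B \<in> carrier_mat s s" using assms(1)
    by (metis carrier_matD(2) carrier_matI index_mult_mat(3) index_one_mat(3))
  then show ?thesis using B assms(1) by (auto simp: Units_def inverts_mat_def ring_mat_simps)
qed

theorem proposition2p3:
  fixes s N :: nat and A :: "nat \<Rightarrow> complex mat"
  assumes "s \<ge> 1" and "N \<ge> 1"
    and "A \<in> mat_seqs s"
    and "invertible_mat (A 0)"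
  shows "trunc_class s N A \<in> Units (trunc_ring s N)
    \<and> trunc_class s N (conv_inv s A) = inv\<^bsub>trunc_ring s N\<^esub> (trunc_class s N A)"
proof -
  let ?R = "mat_ring s" and ?P = "mat_poly_ring s" and ?I = "trunc_ideal s N"
  interpret UP_ring ?R ?P
    by (intro UP_ring.intro ring_mat)
  interpret P: ring ?P by (rule UP_ring)
  have carr: "carrier ?R = carrier_mat s s" by (simp add: ring_mat_simps)
  have conv: "conv s = cauchy_prod ?R"
    by (intro ext) (simp add: conv_def cauchy_prod_def ring_mat_simps)
  have e: "conv_id s = unit_seq ?R"
    by (intro ext) (simp add: conv_id_def unit_seq_def ring_mat_simps)
  have I: "?I = Idl\<^bsub>?P\<^esub> {monom ?P \<one>\<^bsub>?R\<^esub> N}"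
    by (simp add: trunc_ideal_def ring_mat_simps)
  have cls: "trunc_class s N X = ?I +>\<^bsub>?P\<^esub> truncation ?R N X" for X
    by (simp add: trunc_class_def trunc_poly_def truncation_def)
  interpret I: ideal ?I ?P unfolding I by (rule P.genideal_ideal) simp
  interpret h: ring_hom_ring ?P "trunc_ring s N" "(+>\<^bsub>?P\<^esub>) ?I"
    unfolding trunc_ring_def by (rule I.rcos_ring_hom_ring)
  have A: "A \<in> UNIV \<rightarrow> carrier ?R" using assms(3) by (simp only: carr)
  have "A 0 \<in> Units ?R" using assms(3,4) by (auto intro: Units_mat_ring)
  then obtain B where B: "B \<in> UNIV \<rightarrow> carrier ?R"
      "cauchy_prod ?R A B = unit_seq ?R" "cauchy_prod ?R B A = unit_seq ?R"
    using inverse_seq_exists[OF A] by blast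
  \<comment> \<open>Existence and uniqueness of the two-sided inverse discharge the definite
    description in \<open>conv_inv\<close>.\<close>
  have inv: "conv_inv s A = B"
    unfolding conv_inv_def conv e carr[symmetric]
    using B inverse_seq_unique[OF A] by (intro the_equality) blast+
  have mult: "trunc_class s N A \<otimes>\<^bsub>trunc_ring s N\<^esub> trunc_class s N B = \<one>\<^bsub>trunc_ring s N\<^esub>"
      "trunc_class s N B \<otimes>\<^bsub>trunc_ring s N\<^esub> trunc_class s N A = \<one>\<^bsub>trunc_ring s N\<^esub>"
    using truncation_rcos_mult[OF A B(1,2), of N] truncation_rcos_mult[OF B(1) A B(3), of N]
    unfolding cls trunc_ring_def I by blast+
  have closed: "trunc_class s N A \<in> carrier (trunc_ring s N)"
      "trunc_class s N B \<in> carrier (trunc_ring s N)"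
    using A B(1) by (simp_all only: cls truncation_closed h.hom_closed)
  show ?thesis
    using mult closed h.S.inv_unique'[OF closed mult] unfolding inv Units_def by blast
qed

end
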